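(* Let $f,g,h,D,p,p_*,r,\psi$ be as in the context, and let $$U:=p_*f-\tfrac12\,\mathrm{div}(p_*D),$$ which is a divergence-free vector field in $\mathbb R^n$. Suppose the noise drift map $h$ satisfies $h=\tfrac12\psi$ on $\mathbb R^n$, where $\psi=g^{\mathrm T}\nabla\ln r$. Then $$U(x)^{\mathrm T}\nabla r(x)=0\qquad\text{for all }x\in\mathbb R^n,$$ that is, $r$ is preserved by the flow generated by the vector field $U$.
   Context: Setting. Let $f\in C^1(\mathbb R^n,\mathbb R^n)$, $g\in C^2(\mathbb R^n,\mathbb R^{n\times m})$, $h\in C^1(\mathbb R^n,\mathbb R^m)$, and $f_h:=f+gh$, all of these maps being Lipschitz. Let $D(x):=g(x)g(x)^{\mathrm T}$. The nominal system is the Ito SDE $dX_t=f(X_t)\,dt+g(X_t)\,dV_t$ and the perturbed system is $dX_t=f_h(X_t)\,dt+g(X_t)\,dV_t$, with $V$ an $\mathbb R^m$-valued standard Wiener process. For a symmetric-matrix-valued $G=(G_{jk})$ on $\mathbb R^n$, $\mathrm{div}\,G:=(\sum_k\partial_{x_k}G_{jk})_{1\le j\le n}$ and $\mathrm{div}^2G:=\sum_{j,k}\partial_{x_j}\partial_{x_k}G_{jk}$. For $\varphi\in C^2(\mathbb R^n,\mathbb R)$, $$\mathcal L^\dagger(\varphi):=\tfrac12\mathrm{div}^2(\varphi D)-\mathrm{div}(\varphi f_h),\qquad \mathcal L_*^\dagger(\varphi):=\tfrac12\mathrm{div}^2(\varphi D)-\mathrm{div}(\varphi f).$$ Invariant PDFs.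 $p$ and $p_*$ are the (assumed to exist and to be unique) $C^2$ probability density functions on $\mathbb R^n$ satisfying $\mathcal L^\dagger(p)=0$ (perturbed system) and $\mathcal L_*^\dagger(p_* )=0$ (nominal system); both are assumed positive everywhere. Put $r:=p/p_*$ and $\psi(x):=g(x)^{\mathrm T}\nabla\ln r(x)\in\mathbb R^m$. *)

theory Defs
  imports "HOL-Probability.Probability"
begin

(* C^k on the whole space. The derivative is taken direction by direction, so that the type of the
   function does not change in the recursion; in finite dimension this is the same as continuity
   of the Frechet derivatives in operator norm. *)
primrec Ck :: "nat \<Rightarrow> ('a::euclidean_space \<Rightarrow> 'b::real_normed_vector) \<Rightarrow> bool" where
  "Ck 0 F \<longleftrightarrow> continuous_on UNIV F"
| "Ck (Suc k) F \<longleftrightarrow>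
     (\<forall>x. F differentiable (at x)) \<and> (\<forall>v. Ck k (\<lambda>x. frechet_derivative F (at x) v))"

definition pderivative :: "'n::finite \<Rightarrow> (real^'n \<Rightarrow> real) \<Rightarrow> real^'n \<Rightarrow> real" where
  "pderivative k \<phi> x = frechet_derivative \<phi> (at x) (axis k 1)"

definition gradient :: "(real^'n::finite \<Rightarrow> real) \<Rightarrow> real^'n \<Rightarrow> real^'n" where
  "gradient \<phi> x = (\<chi> k. pderivative k \<phi> x)"

definition div_vec :: "(real^'n::finite \<Rightarrow> real^'n) \<Rightarrow> real^'n \<Rightarrow> real" where
  "div_vec F x = (\<Sum>k\<in>UNIV. pderivative k (\<lambda>y. F y $ k) x)"

definition div_mat :: "(real^'n::finite \<Rightarrow> real^'n^'n) \<Rightarrow> real^'n \<Rightarrow> real^'n" where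
  "div_mat G x = (\<chi> j. \<Sum>k\<in>UNIV. pderivative k (\<lambda>y. G y $ j $ k) x)"

definition div2_mat :: "(real^'n::finite \<Rightarrow> real^'n^'n) \<Rightarrow> real^'n \<Rightarrow> real" where
  "div2_mat G x =
     (\<Sum>j\<in>UNIV. \<Sum>k\<in>UNIV. pderivative j (pderivative k (\<lambda>y. G y $ j $ k)) x)"

(* The formal adjoint of the generator of dX = b(X) dt + g(X) dV, where D = g g^T. *)
definition adjoint_generator ::
  "(real^'n::finite \<Rightarrow> real^'n) \<Rightarrow> (real^'n \<Rightarrow> real^'n^'n) \<Rightarrow> (real^'n \<Rightarrow> real) \<Rightarrow> real^'n \<Rightarrow> real" where
  "adjoint_generator b D \<phi> x =
     (1/2) * div2_mat (\<lambda>y. \<phi> y *\<^sub>R D y) x - div_vec (\<lambda>y. \<phi> y *\<^sub>R b y) x"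

(* Nonnegativity is stated separately because ennreal truncates negative values to 0. *)
definition is_pdf :: "(real^'n::finite \<Rightarrow> real) \<Rightarrow> bool" where
  "is_pdf q \<longleftrightarrow> q \<in> borel_measurable borel \<and> (\<forall>x. 0 \<le> q x) \<and>
     prob_space (density lborel (\<lambda>x. ennreal (q x)))"

definition invariant_pdf ::
  "(real^'n::finite \<Rightarrow> real^'n) \<Rightarrow> (real^'n \<Rightarrow> real^'n^'n) \<Rightarrow> (real^'n \<Rightarrow> real) \<Rightarrow> bool" where
  "invariant_pdf b D q \<longleftrightarrow> Ck 2 q \<and> is_pdf q \<and> (\<forall>x. adjoint_generator b D q x = 0)"

(* The flow of U may be only local, so invariance is required along every solution of
   x' = U(x) on an arbitrary time interval. *)
definition preserved_by_flow ::
  "(real^'n::finite \<Rightarrow> real^'n) \<Rightarrow> (real^'n \<Rightarrow> real) \<Rightarrow> bool" where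
  "preserved_by_flow U \<phi> \<longleftrightarrow>
     (\<forall>T \<gamma>. is_interval T \<longrightarrow>
        (\<forall>t\<in>T. (\<gamma> has_vector_derivative U (\<gamma> t)) (at t within T)) \<longrightarrow>
        (\<forall>s\<in>T. \<forall>t\<in>T. \<phi> (\<gamma> s) = \<phi> (\<gamma> t)))"

end

(* The probability flux of the perturbed system satisfies p f_h - div (p D) / 2 = r U: since
   p h = p_* g^T grad r / 2, the drift correction p g h cancels the term p_* D grad r / 2 coming from
   div (r p_* D) = r div (p_* D) + p_* D grad r. Both fluxes are divergence free by stationarity, so
   0 = div (r U) = r div U + U . grad r = U . grad r. *)

theory Submission
  imports Defs
begin

section \<open>Closure properties of the classes \<open>Ck\<close>\<close>

lemma Ck_SucD: "Ck (Suc k) F \<Longrightarrow> Ck k F"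
proof (induction k arbitrary: F)
  case 0
  then show ?case
    by (auto intro!: differentiable_imp_continuous_on simp: differentiable_on_def)
next
  case (Suc k)
  \<comment> \<open>Only the outer successor is unfolded, so that each directional derivative stays
    in \<open>Ck (Suc k)\<close> and fits the induction hypothesis.\<close>
  from Suc.prems have "\<forall>x. F differentiable (at x)"
    and "\<And>v. Ck (Suc k) (\<lambda>x. frechet_derivative F (at x) v)"
    unfolding Ck.simps(2)[of "Suc k"] by blast+
  with Suc.IH show ?case by simp
qed

text \<open>Uniqueness of the derivative lets an explicit formula replace
  \<open>frechet_derivative\<close>. The inductions below feed the sum, chain and product rules
  through this lemma.\<close>

lemma Ck_SucI:
  assumes "\<And>x. (F has_derivative F' x) (at x)" and "\<And>v. Ck k (\<lambda>x. F' x v)"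
  shows "Ck (Suc k) F"
proof -
  have "frechet_derivative F (at x) = F' x" for x
    using assms(1) by (metis frechet_derivative_at)
  with assms show ?thesis by (auto simp: differentiable_def)
qed

lemmas frechet_derivativeI = frechet_derivative_works[THEN iffD1]

lemma Ck_Suc_has_derivative:
  "Ck (Suc k) F \<Longrightarrow> (F has_derivative frechet_derivative F (at x)) (at x)"
  by (simp add: frechet_derivativeI)

lemma Ck_const: "Ck k (\<lambda>x. c)"
  by (induction k arbitrary: c) auto

lemma Ck_add:
  assumes "Ck k F" and "Ck k G"
  shows "Ck k (\<lambda>x. F x + G x)"
  using assms
proof (induction k arbitrary: F G)
  case 0
  then show ?case by (simp add: continuous_on_add)
next
  case (Suc k)
  show ?case
  proof (rule Ck_SucI)
    show "((\<lambda>x. F x + G x) has_derivative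
        (\<lambda>v. frechet_derivative F (at x) v + frechet_derivative G (at x) v)) (at x)" for x
      using Suc.prems by (intro has_derivative_add Ck_Suc_has_derivative)
    show "Ck k (\<lambda>x. frechet_derivative F (at x) v + frechet_derivative G (at x) v)" for v
      using Suc.prems by (intro Suc.IH) simp_all
  qed
qed

lemma Ck_sum:
  assumes "\<And>i. i \<in> I \<Longrightarrow> Ck k (F i)"
  shows "Ck k (\<lambda>x. \<Sum>i\<in>I. F i x)"
  using assms by (induction I rule: infinite_finite_induct) (auto intro: Ck_const Ck_add)

lemma Ck_bounded_linear:
  assumes "bounded_linear L" and "Ck k F"
  shows "Ck k (\<lambda>x. L (F x))"
  using assms(2)
proof (induction k arbitrary: F)
  case 0
  then show ?case
    by (auto intro: bounded_linear.continuous_on[OF assms(1)])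
next
  case (Suc k)
  show ?case
  proof (rule Ck_SucI)
    show "((\<lambda>x. L (F x)) has_derivative (\<lambda>v. L (frechet_derivative F (at x) v))) (at x)" for x
      using Suc.prems by (intro bounded_linear.has_derivative[OF assms(1)] Ck_Suc_has_derivative)
    show "Ck k (\<lambda>x. L (frechet_derivative F (at x) v))" for v
      using Suc.prems by (intro Suc.IH) simp
  qed
qed

text \<open>The product rule gives two terms of the same shape \<open>B (F x) (G x)\<close>.
  Directional derivatives keep the types of \<open>F\<close> and \<open>G\<close>, so the induction
  hypothesis applies to each term.\<close>

lemma Ck_bounded_bilinear:
  assumes "bounded_bilinear B" and "Ck k F" and "Ck k G"
  shows "Ck k (\<lambda>x. B (F x) (G x))"
  using assms(2,3)
proof (induction k arbitrary: F G)
  case 0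
  then show ?case
    by (auto intro: bounded_bilinear.continuous_on[OF assms(1)])
next
  case (Suc k)
  show ?case
  proof (rule Ck_SucI)
    show "((\<lambda>x. B (F x) (G x)) has_derivative
        (\<lambda>v. B (F x) (frechet_derivative G (at x) v) + B (frechet_derivative F (at x) v) (G x))) (at x)"
      for x
      using Suc.prems
      by (intro bounded_bilinear.FDERIV[OF assms(1)] Ck_Suc_has_derivative)
    show "Ck k (\<lambda>x. B (F x) (frechet_derivative G (at x) v) + B (frechet_derivative F (at x) v) (G x))"
      for v
      \<comment> \<open>Each summand pairs a derivative with an undifferentiated factor, whose order
        has to be lowered from \<open>Suc k\<close> to \<open>k\<close>.\<close>
      using Suc.prems Ck_SucD[OF Suc.prems(1)] Ck_SucD[OF Suc.prems(2)]
      by (intro Ck_add Suc.IH) auto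
  qed
qed

lemmas Ck_mult = Ck_bounded_bilinear[OF bounded_bilinear_mult]

lemma Ck_vec_nth: "Ck k F \<Longrightarrow> Ck k (\<lambda>x. F x $ i)"
  by (rule Ck_bounded_linear[OF bounded_linear_vec_nth])

text \<open>A map is the sum of its coordinates embedded by the bounded linear maps
  \<open>axis i\<close>. This reduces regularity of matrix products to that of their
  entries.\<close>

lemma Ck_vec_componentwise:
  fixes F :: "'a::euclidean_space \<Rightarrow> 'b::real_normed_vector^'n"
  assumes "\<And>i. Ck k (\<lambda>x. F x $ i)"
  shows "Ck k F"
proof -
  have bl: "bounded_linear (axis i :: 'b \<Rightarrow> 'b^'n)" for i
  proof (rule bounded_linear_intro[where K = 1])
    fix x :: 'b
    \<comment> \<open>The Euclidean norm is bounded by the sum of the coordinate norms, of which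
      only the one at \<open>i\<close> is nonzero.\<close>
    have "norm (axis i x) \<le> (\<Sum>j\<in>UNIV. norm (axis i x $ j))"
      unfolding norm_vec_def by (intro L2_set_le_sum) simp
    also have "\<dots> = (\<Sum>j\<in>UNIV. if j = i then norm x else 0)"
      by (intro sum.cong) (auto simp: axis_def)
    finally show "norm (axis i x) \<le> norm x * 1"
      by simp
  qed (simp_all add: axis_def vec_eq_iff)
  have "F = (\<lambda>x. \<Sum>i\<in>UNIV. axis i (F x $ i))"
    by (simp add: fun_eq_iff vec_eq_iff axis_def)
  moreover have "Ck k (\<lambda>x. \<Sum>i\<in>UNIV. axis i (F x $ i))"
    by (intro Ck_sum Ck_bounded_linear[OF bl] assms)
  ultimately show ?thesis
    by simp
qed

section \<open>Partial derivatives, gradients and divergences\<close>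

lemma Ck_pderivative: "Ck (Suc k) F \<Longrightarrow> Ck k (pderivative i F)"
  unfolding pderivative_def by simp

lemma pderivative_eqI:
  "(F has_derivative F') (at x) \<Longrightarrow> pderivative k F x = F' (axis k 1)"
  unfolding pderivative_def by (metis frechet_derivative_at)

lemma pderivative_diff:
  assumes "F differentiable (at x)" and "G differentiable (at x)"
  shows "pderivative k (\<lambda>y. F y - G y) x = pderivative k F x - pderivative k G x"
  by (subst pderivative_eqI[OF has_derivative_diff[OF assms[THEN frechet_derivativeI]]])
    (simp add: pderivative_def)

lemma pderivative_sum:
  assumes "\<And>i. i \<in> I \<Longrightarrow> F i differentiable (at x)"
  shows "pderivative k (\<lambda>y. \<Sum>i\<in>I. F i y) x = (\<Sum>i\<in>I. pderivative k (F i) x)"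
  by (subst pderivative_eqI[OF has_derivative_sum[OF assms[THEN frechet_derivativeI]]])
    (simp_all add: pderivative_def)

lemma pderivative_mult:
  assumes "F differentiable (at x)" and "G differentiable (at x)"
  shows "pderivative k (\<lambda>y. F y * G y) x = F x * pderivative k G x + pderivative k F x * G x"
  by (subst pderivative_eqI[OF has_derivative_mult[OF assms[THEN frechet_derivativeI]]])
    (simp add: pderivative_def)

lemma pderivative_cmult:
  assumes "F differentiable (at x)"
  shows "pderivative k (\<lambda>y. c * F y) x = c * pderivative k F x"
  by (subst pderivative_eqI[OF has_derivative_mult_right[OF assms[THEN frechet_derivativeI]]])
    (simp add: pderivative_def)

lemma pderivative_ln:
  assumes "F differentiable (at x)" and "F x > 0"
  shows "pderivative k (\<lambda>y. ln (F y)) x = pderivative k F x / F x"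
  by (subst pderivative_eqI[OF has_derivative_ln[OF assms(2) assms(1)[THEN frechet_derivativeI]]])
    (simp add: pderivative_def divide_inverse)

text \<open>Linearity and expansion of \<open>v\<close> in the standard basis. This converts the
  chain rule along a trajectory into an inner product with the gradient.\<close>

lemma frechet_derivative_eq_inner_gradient:
  assumes "F differentiable (at x)"
  shows "frechet_derivative F (at x) v = v \<bullet> gradient F x"
proof -
  interpret linear "frechet_derivative F (at x)"
    using assms by (rule linear_frechet_derivative)
  have "frechet_derivative F (at x) v = frechet_derivative F (at x) (\<Sum>k\<in>UNIV. v $ k *s axis k 1)"
    by (simp add: basis_expansion)
  also have "\<dots> = v \<bullet> gradient F x"
    by (simp add: sum scale scalar_mult_eq_scaleR gradient_def inner_vec_def pderivative_def)
  finally show ?thesis .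
qed

text \<open>Leibniz rule in each coordinate. When \<open>F\<close> is divergence free, only the
  directional derivative of \<open>r\<close> along \<open>F\<close> remains.\<close>

lemma div_vec_scaleR:
  assumes "r differentiable (at x)" and "\<And>k. (\<lambda>y. F y $ k) differentiable (at x)"
  shows "div_vec (\<lambda>y. r y *\<^sub>R F y) x = r x * div_vec F x + F x \<bullet> gradient r x"
  using assms
  by (simp add: div_vec_def pderivative_mult gradient_def inner_vec_def sum.distrib
      sum_distrib_left mult.commute)

text \<open>Leibniz rule in each entry; summing over the column index collects the derivatives of
  \<open>r\<close> into a matrix-vector product.\<close>

lemma div_mat_scaleR:
  assumes "r differentiable (at x)" and "\<And>j k. (\<lambda>y. G y $ j $ k) differentiable (at x)"
  shows "div_mat (\<lambda>y. r y *\<^sub>R G y) x = r x *\<^sub>R div_mat G x + G x *v gradient r x"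
  using assms
  by (simp add: div_mat_def pderivative_mult gradient_def matrix_vector_mult_def sum.distrib
      sum_distrib_left vec_eq_iff mult.commute)

section \<open>The probability flux of the stationary Fokker-Planck equation\<close>

definition flux ::
  "(real^'n::finite \<Rightarrow> real^'n) \<Rightarrow> (real^'n \<Rightarrow> real^'n^'n) \<Rightarrow> (real^'n \<Rightarrow> real) \<Rightarrow> real^'n \<Rightarrow> real^'n" where
  "flux b D q x = q x *\<^sub>R b x - (1/2) *\<^sub>R div_mat (\<lambda>y. q y *\<^sub>R D y) x"

lemma flux_component:
  "flux b D q x $ j =
    q x * b x $ j - (1/2) * (\<Sum>k\<in>UNIV. pderivative k (\<lambda>y. q y * D y $ j $ k) x)"
  by (simp add: flux_def div_mat_def)

context
  fixes b :: "real^'n \<Rightarrow> real^'n" and D :: "real^'n \<Rightarrow> real^'n^'n" and q :: "real^'n \<Rightarrow> real"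
  assumes b: "Ck 1 b" and D: "Ck 2 D" and q: "Ck 2 q"
begin

lemma drift_term_differentiable: "(\<lambda>y. q y * b y $ j) differentiable (at x)"
proof -
  have "(\<lambda>y. b y $ j) differentiable (at x)" "q differentiable (at x)"
    using Ck_vec_nth[OF b] q by (simp_all add: numeral_2_eq_2)
  then show ?thesis
    by (rule differentiable_mult[rotated])
qed

text \<open>Of the two derivatives granted by C^2, one is spent inside the flux; the other is left
  for taking its divergence.\<close>

lemma diffusion_term_differentiable:
  "pderivative k (\<lambda>y. q y * D y $ j $ k) differentiable (at x)"
proof -
  have "Ck (Suc 1) (\<lambda>y. q y * D y $ j $ k)"
    using Ck_mult[OF q Ck_vec_nth[OF Ck_vec_nth[OF D]]] by (simp only: Suc_1)
  then have "Ck 1 (pderivative k (\<lambda>y. q y * D y $ j $ k))"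
    by (rule Ck_pderivative)
  then show ?thesis
    by simp
qed

lemma div_term_differentiable:
  "(\<lambda>y. \<Sum>k\<in>UNIV. pderivative k (\<lambda>y. q y * D y $ j $ k) y) differentiable (at x)"
  using diffusion_term_differentiable by (intro differentiable_sum) auto

lemma flux_component_differentiable: "(\<lambda>y. flux b D q y $ j) differentiable (at x)"
  unfolding flux_component
  by (intro differentiable_diff[OF drift_term_differentiable]
      differentiable_mult[OF differentiable_const div_term_differentiable])

text \<open>This is the divergence form of the Fokker-Planck operator: stationarity of
  \<open>q\<close> means that its flux is divergence free. The derivatives in \<open>k\<close>
  (inner) and \<open>j\<close> (outer) occur in the same order as in \<open>div2_mat\<close>, so the
  terms match one by one.\<close>

lemma div_vec_flux: "div_vec (flux b D q) x = - adjoint_generator b D q x"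
proof -
  have "pderivative j (\<lambda>y. flux b D q y $ j) x =
      pderivative j (\<lambda>y. q y * b y $ j) x
      - (1/2) * (\<Sum>k\<in>UNIV. pderivative j (pderivative k (\<lambda>y. q y * D y $ j $ k)) x)" for j
    unfolding flux_component
    by (subst pderivative_diff[OF drift_term_differentiable
          differentiable_mult[OF differentiable_const div_term_differentiable]],
        subst pderivative_cmult[OF div_term_differentiable],
        subst pderivative_sum[OF diffusion_term_differentiable], rule refl)
  then show ?thesis
    by (simp add: div_vec_def adjoint_generator_def div2_mat_def sum_subtractf sum_distrib_left)
qed

end

text \<open>By the chain rule \<open>r\<close> has zero derivative along a trajectory, hence is
  constant on the convex set \<open>T\<close>. Derivatives are taken within \<open>T\<close>, which
  covers endpoints belonging to the interval.\<close>

lemma preserved_by_flow_if_orthogonal: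
  assumes r: "\<And>x. r differentiable (at x)" and orth: "\<And>x. U x \<bullet> gradient r x = 0"
  shows "preserved_by_flow U r"
  unfolding preserved_by_flow_def
proof (intro allI impI ballI)
  fix T :: "real set" and \<gamma> s t
  assume T: "is_interval T" and st: "s \<in> T" "t \<in> T"
    and \<gamma>: "\<forall>t\<in>T. (\<gamma> has_vector_derivative U (\<gamma> t)) (at t within T)"
  have "((\<lambda>t. r (\<gamma> t)) has_derivative (\<lambda>h. 0)) (at u within T)" if "u \<in> T" for u
  proof -
    have "(\<gamma> has_derivative (\<lambda>h. h *\<^sub>R U (\<gamma> u))) (at u within T)"
      using \<gamma> that by (simp add: has_vector_derivative_def)
    from has_derivative_compose[OF this frechet_derivativeI[OF r]]
    have "((\<lambda>t. r (\<gamma> t)) has_derivative (\<lambda>h. frechet_derivative r (at (\<gamma> u)) (h *\<^sub>R U (\<gamma> u))))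
        (at u within T)" .
    then show ?thesis
      by (simp add: frechet_derivative_eq_inner_gradient[OF r] orth)
  qed
  moreover have "convex T"
    using T by (rule is_interval_convex)
  ultimately obtain c where "\<And>u. u \<in> T \<Longrightarrow> r (\<gamma> u) = c"
    using has_derivative_zero_constant[of T "\<lambda>t. r (\<gamma> t)"] by blast
  then show "r (\<gamma> s) = r (\<gamma> t)"
    using st by simp
qed

theorem theorem5:
  fixes f fh :: "real^'n \<Rightarrow> real^'n"
    and g :: "real^'n \<Rightarrow> real^'m^'n"
    and h \<psi> :: "real^'n \<Rightarrow> real^'m"
    and D :: "real^'n \<Rightarrow> real^'n^'n"
    and p p_star r :: "real^'n \<Rightarrow> real"
    and U :: "real^'n \<Rightarrow> real^'n"
  assumes f_C1: "Ck 1 f" and g_C2: "Ck 2 g" and h_C1: "Ck 1 h"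
    and fh: "fh = (\<lambda>x. f x + g x *v h x)"
    and f_lip: "\<exists>L. L-lipschitz_on UNIV f"
    and g_lip: "\<exists>L. L-lipschitz_on UNIV g"
    and h_lip: "\<exists>L. L-lipschitz_on UNIV h"
    and fh_lip: "\<exists>L. L-lipschitz_on UNIV fh"
    and D: "D = (\<lambda>x. g x ** transpose (g x))"
    and p_inv: "invariant_pdf fh D p"
    and p_unique: "\<And>q. invariant_pdf fh D q \<Longrightarrow> q = p"
    and p_pos: "\<And>x. p x > 0"
    and p_star_inv: "invariant_pdf f D p_star"
    and p_star_unique: "\<And>q. invariant_pdf f D q \<Longrightarrow> q = p_star"
    and p_star_pos: "\<And>x. p_star x > 0"
    and r: "r = (\<lambda>x. p x / p_star x)"
    and psi: "\<psi> = (\<lambda>x. transpose (g x) *v gradient (\<lambda>y. ln (r y)) x)"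
    and U: "U = (\<lambda>x. p_star x *\<^sub>R f x - (1/2) *\<^sub>R div_mat (\<lambda>y. p_star y *\<^sub>R D y) x)"
    and h_psi: "\<And>x. h x = (1/2) *\<^sub>R \<psi> x"
  shows "(\<forall>x. div_vec U x = 0) \<and> (\<forall>x. U x \<bullet> gradient r x = 0) \<and> preserved_by_flow U r"
proof -
  have p_C2: "Ck 2 p" and ps_C2: "Ck 2 p_star"
    using p_inv p_star_inv by (auto simp: invariant_pdf_def)
  have p_diff: "p differentiable (at x)" and ps_diff: "p_star differentiable (at x)" for x
    using p_C2 ps_C2 by (auto simp: numeral_2_eq_2)
  have entries: "Ck 2 (\<lambda>x. g x $ i $ j)" for i j
    using g_C2 by (intro Ck_vec_nth)
  have D_C2: "Ck 2 D"
    \<comment> \<open>The componentwise criterion is used for rows and then for columns; each entry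
      is a sum of products of entries of \<open>g\<close>.\<close>
    unfolding D matrix_matrix_mult_def transpose_def
    by (intro Ck_vec_componentwise, simp only: vec_lambda_beta, intro Ck_sum Ck_mult entries)
  have fh_C1: "Ck 1 fh"
  proof -
    have "Ck 1 (\<lambda>x. g x $ i $ j)" for i j
      by (rule Ck_SucD) (simp only: Suc_1 entries)
    then show ?thesis
      unfolding fh matrix_vector_mult_def
      by (intro Ck_add f_C1, intro Ck_vec_componentwise, simp only: vec_lambda_beta,
          intro Ck_sum Ck_mult Ck_vec_nth[OF h_C1])
  qed
  have r_diff: "r differentiable (at x)" for x
    unfolding r using p_diff ps_diff p_star_pos[of x] by (intro differentiable_divide) auto
  have p_eq: "p x = r x * p_star x" and r_pos: "r x > 0" for x
    using p_pos[of x] p_star_pos[of x] by (auto simp: r)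
  have U_flux: "U = flux f D p_star"
    by (auto simp: U flux_def)
  have pf: "p x *\<^sub>R fh x = (r x * p_star x) *\<^sub>R f x + ((1/2) * p_star x) *\<^sub>R (D x *v gradient r x)" for x
  proof -
    have "gradient (\<lambda>y. ln (r y)) x = (1 / r x) *\<^sub>R gradient r x"
      by (simp add: gradient_def vec_eq_iff pderivative_ln[OF r_diff r_pos])
    \<comment> \<open>Associativity turns \<open>g\<close> applied to its transpose into
      \<open>D\<close>; the simp rule for transposes is removed to keep that product visible. The
      factor 2 comes from \<open>h_psi\<close>, and \<open>r x\<close> from the logarithm; the
      latter cancels against \<open>p = r * p_star\<close>.\<close>
    then have "g x *v h x = (1 / (2 * r x)) *\<^sub>R (D x *v gradient r x)"
      unfolding h_psi psi D
      by (simp add: matrix_vector_mul_assoc matrix_vector_mult_scaleR del: transpose_matrix_vector)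
    then show ?thesis
      using r_pos[of x] by (simp add: fh p_eq scaleR_add_right)
  qed
  have flux_eq: "flux fh D p = (\<lambda>x. r x *\<^sub>R U x)"
  proof
    fix x
    have "(\<lambda>y. (p_star y *\<^sub>R D y) $ j $ k) differentiable (at x)" for j k
      using Ck_mult[OF ps_C2 Ck_vec_nth[OF Ck_vec_nth[OF D_C2]], of j k]
      by (simp add: numeral_2_eq_2)
    \<comment> \<open>With \<open>p\<close> split as \<open>r * p_star\<close>, half of the gradient
      term here equals the one in \<open>pf\<close>, so the two cancel in the flux.\<close>
    then have "div_mat (\<lambda>y. p y *\<^sub>R D y) x =
        r x *\<^sub>R div_mat (\<lambda>y. p_star y *\<^sub>R D y) x + p_star x *\<^sub>R (D x *v gradient r x)"
      using div_mat_scaleR[OF r_diff, of "\<lambda>y. p_star y *\<^sub>R D y" x]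
      unfolding p_eq scaleR_scaleR[symmetric] scaleR_matrix_vector_assoc by blast
    then show "flux fh D p x = r x *\<^sub>R U x"
      unfolding flux_def U pf by (simp add: scaleR_diff_right scaleR_add_right)
  qed
  have div_U: "div_vec U x = 0" for x
    using p_star_inv by (simp add: U_flux div_vec_flux[OF f_C1 D_C2 ps_C2] invariant_pdf_def)
  have orth: "U x \<bullet> gradient r x = 0" for x
  proof -
    have "div_vec (flux fh D p) x = 0"
      using p_inv by (simp add: div_vec_flux[OF fh_C1 D_C2 p_C2] invariant_pdf_def)
    moreover have "div_vec (\<lambda>y. r y *\<^sub>R U y) x = r x * div_vec U x + U x \<bullet> gradient r x"
      unfolding U_flux
      by (intro div_vec_scaleR r_diff flux_component_differentiable f_C1 D_C2 ps_C2)
    ultimately show ?thesis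
      by (simp add: flux_eq div_U)
  qed
  show ?thesis
    using div_U orth preserved_by_flow_if_orthogonal[OF r_diff orth] by blast
qed

end
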